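(* Let $n,i,j$ be integers with $0<i<j\le n/2$ such that either $i=1$ or neither $i$ nor $j$ is a unit in $\mathbb{Z}_n$. If $C_n(i,j)$ is connected (equivalently $\gcd(n,i,j)=1$), twin-free, and $(n,i,j)\neq(10,1,3)$, then $\operatorname{Aut}(C_n(i,j))=\mathbb{Z}_n\rtimes H$, where the action of $(s,t)\in\mathbb{Z}_n\rtimes H$ on a vertex $a$ of $C_n(i,j)$ is $(s,t)\cdot a=s+ta$.
   Context: $C_n(i,j)$ is the simple undirected graph with vertex set $\mathbb{Z}_n$ in which $a,b$ are adjacent iff $a-b\equiv\pm i$ or $a-b\equiv\pm j\pmod n$. Distinct vertices $v,w$ are twins if $N(v)=N(w)$ or $N[v]=N[w]$ (open, resp. closed neighborhoods); a graph is twin-free if no two distinct vertices are twins. $U(n)$ is the group of units of $\mathbb{Z}_n$, and $H=\{t\in U(n): t\{\pm i,\pm j\}=\{\pm i,\pm j\}\}$. In $\mathbb{Z}_n\rtimes H$, multiplication is $(s,t)(s',t')=(s+ts',tt')$. *)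

theory Defs
  imports
    "HOL-Number_Theory.Residues"
    "HOL-Algebra.Bij"
    "Graph_Theory.Graph_Theory"
begin

definition circulant :: "int \<Rightarrow> int \<Rightarrow> int \<Rightarrow> int pair_pre_digraph" where
  "circulant n i j =
    \<lparr>pverts = carrier (residue_ring n),
     parcs = {(a, b) \<in> carrier (residue_ring n) \<times> carrier (residue_ring n).
       [a - b = i] (mod n) \<or> [a - b = - i] (mod n) \<or>
       [a - b = j] (mod n) \<or> [a - b = - j] (mod n)}\<rparr>"

definition nbhd :: "'a pair_pre_digraph \<Rightarrow> 'a \<Rightarrow> 'a set" where
  "nbhd G v = {w \<in> pverts G. (v, w) \<in> parcs G}"

definition closed_nbhd :: "'a pair_pre_digraph \<Rightarrow> 'a \<Rightarrow> 'a set" where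
  "closed_nbhd G v = insert v (nbhd G v)"

definition twins :: "'a pair_pre_digraph \<Rightarrow> 'a \<Rightarrow> 'a \<Rightarrow> bool" where
  "twins G v w \<longleftrightarrow>
    v \<noteq> w \<and> (nbhd G v = nbhd G w \<or> closed_nbhd G v = closed_nbhd G w)"

definition twin_free :: "'a pair_pre_digraph \<Rightarrow> bool" where
  "twin_free G \<longleftrightarrow> (\<forall>v \<in> pverts G. \<forall>w \<in> pverts G. \<not> twins G v w)"

definition graph_auto :: "'a pair_pre_digraph \<Rightarrow> ('a \<Rightarrow> 'a) set" where
  "graph_auto G = {f \<in> Bij (pverts G).
    \<forall>a \<in> pverts G. \<forall>b \<in> pverts G. (f a, f b) \<in> parcs G \<longleftrightarrow> (a, b) \<in> parcs G}"

definition GraphAutoGroup :: "'a pair_pre_digraph \<Rightarrow> ('a \<Rightarrow> 'a) monoid" where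
  "GraphAutoGroup G = BijGroup (pverts G) \<lparr>carrier := graph_auto G\<rparr>"

text \<open>The semidirect product with respect to an action \<open>\<phi>\<close> of the second factor on the first.\<close>

definition semidirect ::
  "('a, 'm) monoid_scheme \<Rightarrow> ('b \<Rightarrow> 'a \<Rightarrow> 'a) \<Rightarrow> ('b, 'n) monoid_scheme \<Rightarrow> ('a \<times> 'b) monoid" where
  "semidirect N \<phi> K =
    \<lparr>carrier = carrier N \<times> carrier K,
     monoid.mult = \<lambda>(s, t) (s', t'). (s \<otimes>\<^bsub>N\<^esub> \<phi> t s', t \<otimes>\<^bsub>K\<^esub> t'),
     one = (\<one>\<^bsub>N\<^esub>, \<one>\<^bsub>K\<^esub>)\<rparr>"

definition connection_set :: "int \<Rightarrow> int \<Rightarrow> int \<Rightarrow> int set" where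
  "connection_set n i j =
    {i mod n, \<ominus>\<^bsub>residue_ring n\<^esub> (i mod n), j mod n, \<ominus>\<^bsub>residue_ring n\<^esub> (j mod n)}"

definition multipliers :: "int \<Rightarrow> int \<Rightarrow> int \<Rightarrow> int set" where
  "multipliers n i j = {t \<in> Units (residue_ring n).
    (\<lambda>x. t \<otimes>\<^bsub>residue_ring n\<^esub> x) ` connection_set n i j = connection_set n i j}"

definition affine_group :: "int \<Rightarrow> int \<Rightarrow> int \<Rightarrow> (int \<times> int) monoid" where
  "affine_group n i j =
    semidirect (add_monoid (residue_ring n))
      (\<lambda>t s. t \<otimes>\<^bsub>residue_ring n\<^esub> s)
      (units_of (residue_ring n) \<lparr>carrier := multipliers n i j\<rparr>)"

text \<open>Restricted to the vertex set, because the elements of \<open>Bij S\<close> are extensional on \<open>S\<close>.\<close>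

definition affine_action :: "int \<Rightarrow> int \<times> int \<Rightarrow> int \<Rightarrow> int" where
  "affine_action n = (\<lambda>(s, t). \<lambda>a \<in> carrier (residue_ring n).
    s \<oplus>\<^bsub>residue_ring n\<^esub> t \<otimes>\<^bsub>residue_ring n\<^esub> a)"

lemma pair_graph_circulant:
  assumes "0 < i" "i < j" "2 * j \<le> n"
  shows "pair_graph (circulant n i j)"
proof
  show "finite (pverts (circulant n i j))"
    by (simp add: circulant_def residue_ring_def)
  show "finite (parcs (circulant n i j))"
    by (rule finite_subset[of _ "{0..n - 1} \<times> {0..n - 1}"])
      (auto simp: circulant_def residue_ring_def)
  fix e assume e: "e \<in> parcs (circulant n i j)"
  then show "fst e \<in> pverts (circulant n i j)" "snd e \<in> pverts (circulant n i j)"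
    by (auto simp: circulant_def)
  have "\<not> n dvd i" "\<not> n dvd j"
    using assms by (auto dest: zdvd_imp_le)
  with e show "fst e \<noteq> snd e"
    by (auto simp: circulant_def cong_0_iff cong_sym_eq[of 0])
next
  have "[b - a = c] (mod n) \<longleftrightarrow> [a - b = - c] (mod n)" for a b c :: int
    using cong_minus_minus_iff[of "a - b" "- c" n] by simp
  from this[of _ _ i] this[of _ _ "- i"] this[of _ _ j] this[of _ _ "- j"]
  have "(b, a) \<in> parcs (circulant n i j)" if "(a, b) \<in> parcs (circulant n i j)" for a b
    using that unfolding circulant_def by simp blast
  then show "symmetric (with_proj (circulant n i j))"
    unfolding symmetric_def by (simp add: sym_def)
qed

lemma group_GraphAutoGroup: "group (GraphAutoGroup G)"
proof -
  interpret B: group "BijGroup (pverts G)"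
    by (rule group_BijGroup)
  have "subgroup (graph_auto G) (BijGroup (pverts G))"
  proof (rule B.subgroupI)
    show "graph_auto G \<subseteq> carrier (BijGroup (pverts G))"
      by (auto simp: graph_auto_def BijGroup_def)
    have "(\<lambda>x \<in> pverts G. x) \<in> graph_auto G"
      by (auto simp: graph_auto_def id_Bij)
    then show "graph_auto G \<noteq> {}"
      by blast
  next
    fix f assume f: "f \<in> graph_auto G"
    then have B: "f \<in> Bij (pverts G)"
      by (simp add: graph_auto_def)
    let ?g = "restrict (inv_into (pverts G) f) (pverts G)"
    have g: "f (?g x) = x" "?g x \<in> pverts G" if "x \<in> pverts G" for x
      using B that Bij_inv_into_mem[OF B that]
      by (simp_all add: Bij_def bij_betw_def f_inv_into_f)
    have "(?g a, ?g b) \<in> parcs G \<longleftrightarrow> (a, b) \<in> parcs G"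
      if "a \<in> pverts G" "b \<in> pverts G" for a b
    proof -
      have "(f (?g a), f (?g b)) \<in> parcs G \<longleftrightarrow> (?g a, ?g b) \<in> parcs G"
        using f g(2)[OF that(1)] g(2)[OF that(2)] unfolding graph_auto_def by blast
      then show ?thesis
        unfolding g(1)[OF that(1)] g(1)[OF that(2)] by blast
    qed
    moreover have "?g \<in> Bij (pverts G)"
      using B by (rule restrict_inv_into_Bij)
    ultimately show "inv\<^bsub>BijGroup (pverts G)\<^esub> f \<in> graph_auto G"
      unfolding inv_BijGroup[OF B] graph_auto_def by blast
  next
    fix f g assume "f \<in> graph_auto G" "g \<in> graph_auto G"
    then show "f \<otimes>\<^bsub>BijGroup (pverts G)\<^esub> g \<in> graph_auto G"
      by (auto simp: graph_auto_def BijGroup_def compose_Bij compose_eq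
          dest: Bij_imp_funcset)
  qed
  then show ?thesis
    unfolding GraphAutoGroup_def by (rule B.subgroup_imp_group)
qed

end

theory Submission
  imports Defs
begin

text \<open>
  An automorphism of \<open>C\<^sub>n(i, j)\<close> is viewed as a function \<open>f\<close> on the integers modulo \<open>n\<close>. The heart of
  the matter is that \<open>f\<close> is affine. This follows once the second differences
  \<open>f (x + p + q) - f (x + p) - f (x + q) + f x\<close> vanish modulo \<open>n\<close> for all pairs of steps from a set that
  generates \<open>\<int>\<^sub>n\<close> (lemma \<open>affine_if_second_differences_vanish\<close>): the first difference in such a step is then
  constant, and so is the difference in every sum of such steps, in particular in the step \<open>1\<close>.

  Second differences are controlled by counting common neighbours. If \<open>v\<close> is the only common neighbour of
  \<open>v + p\<close> and \<open>v - p\<close>, then the two images are opposite at \<open>f v\<close>, because for steps \<open>x \<noteq> - y\<close> the vertices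
  \<open>f v + x\<close> and \<open>f v + y\<close> have the second common neighbour \<open>f v + x + y\<close>. In the same way,
  if \<open>v\<close> and \<open>v + p + q\<close> are the only common neighbours of \<open>v + p\<close> and \<open>v + q\<close>, then \<open>f\<close> maps this
  parallelogram to a parallelogram. Common neighbours correspond to representations of an element as a difference
  of two steps, so they are as few as this unless there is a coincidence among the sums \<open>\<plusminus>2i\<close>, \<open>\<plusminus>2j\<close>,
  \<open>\<plusminus>i \<plusminus> j\<close>. The coincidences are the following.

  \<^item> \<open>2i = \<plusminus>2j\<close>. As \<open>0 < 2(j - i) < n\<close>, the sign is negative. Then translation by \<open>i + j\<close> maps the set of steps
  to itself, and there are twins.

  \<^item> \<open>4i = 0\<close> or \<open>4j = 0\<close>. Both together force \<open>n = 4\<close>, that is \<open>K\<^sub>4\<close>. So one may choose \<open>p\<close> among \<open>i\<close>, \<open>j\<close>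
  with \<open>4p \<noteq> 0\<close>. The pair of opposite steps \<open>\<plusminus>p\<close> is preserved, and the other pair is then
  preserved because it is the complement (locale \<open>generic_circulant_automorphism\<close>). This also covers
  the cubic graphs, where \<open>2j = 0\<close>.

  \<^item> One step is \<open>\<plusminus>3\<close> times the other one, \<open>p\<close>. Then \<open>p\<close> is a unit, and apart from some small \<open>n\<close> two distinct
  steps have a difference with three representations only if they differ by \<open>\<plusminus>2p\<close>. This relation makes the
  neighbourhood of \<open>v\<close> a path \<open>v + 3p, v + p, v - p, v - 3p\<close>, so the pair \<open>v \<plusminus> p\<close> of its inner vertices is
  preserved (locale \<open>triple_circulant_automorphism\<close>). The small values of \<open>n\<close> lead to the first coincidence, to
  \<open>K\<^sub>5\<close> and \<open>K\<^sub>3\<^sub>,\<^sub>3\<close>, which have twins, and to \<open>C\<^sub>1\<^sub>0(1, 3)\<close>.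

  An affine automorphism \<open>x \<mapsto> s + t x\<close> is determined by \<open>s\<close> and \<open>t\<close>; surjectivity makes \<open>t\<close> a unit,
  and preservation of the edges at \<open>0\<close> puts \<open>t\<close> into \<open>H\<close>.
\<close>

section \<open>The set of steps modulo n\<close>

text \<open>
  The connection set, saturated under congruence modulo \<open>n\<close>. Working with all integers instead of
  representatives leaves only divisibility by \<open>n\<close> of integer linear combinations to reason about.
\<close>

definition steps :: "int \<Rightarrow> int \<Rightarrow> int \<Rightarrow> int set" where
  "steps n p q = {s. \<exists>e \<in> {p, - p, q, - q}. [s = e] (mod n)}"

lemma steps_cong:
  assumes "[s = s'] (mod n)"
  shows "s \<in> steps n p q \<longleftrightarrow> s' \<in> steps n p q"
  using assms by (auto simp: steps_def cong_def)

lemma steps_members: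
  "p \<in> steps n p q" "- p \<in> steps n p q" "q \<in> steps n p q" "- q \<in> steps n p q"
  by (auto simp: steps_def)

lemma steps_uminus: "- s \<in> steps n p q \<longleftrightarrow> s \<in> steps n p q"
proof -
  have "[- s = e] (mod n) \<longleftrightarrow> [s = - e] (mod n)" for e
    using cong_minus_minus_iff[of s "- e" n] by simp
  then show ?thesis by (auto simp: steps_def)
qed

lemma steps_swap: "steps n p q = steps n q p"
  by (auto simp: steps_def)

lemma steps_uminus_right: "steps n p (- q) = steps n p q"
  by (auto simp: steps_def)

lemma steps_cong_right:
  assumes "[q = q'] (mod n)"
  shows "steps n p q = steps n p q'"
proof -
  have "[- q = - q'] (mod n)"
    using assms by (simp add: cong_minus_minus_iff)
  with assms show ?thesis
    unfolding steps_def by (auto simp: cong_def)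
qed

text \<open>
  A step \<open>r\<close> such that \<open>r - d\<close> is also a step is the same as a common neighbour of two vertices at difference \<open>d\<close>.
  The lemma reduces a count of such steps to a finite case distinction.
\<close>

lemma steps_differenceE:
  assumes "r \<in> steps n p q" "r - d \<in> steps n p q"
  obtains e e' where "e \<in> {p, - p, q, - q}" "e' \<in> {p, - p, q, - q}" "[r = e] (mod n)"
    "n dvd e - e' - d"
proof -
  obtain e e' where e: "e \<in> {p, - p, q, - q}" "e' \<in> {p, - p, q, - q}"
    "[r = e] (mod n)" "[r - d = e'] (mod n)"
    using assms unfolding steps_def by blast
  have "n dvd (r - d - e') - (r - e)"
    using e(3,4) unfolding cong_iff_dvd_diff by (rule dvd_diff[rotated])
  then have "n dvd e - e' - d" by (simp add: algebra_simps)
  with e show thesis using that by blast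
qed

lemma dvd_uminus_diff:
  fixes n a b :: int
  shows "n dvd - a - b \<longleftrightarrow> n dvd a + b"
  using dvd_minus_iff[of n "a + b"] by simp

section \<open>Common neighbours without coincidences\<close>

text \<open>
  Modulo \<open>n\<close>, the hypotheses still allow \<open>2 * q = 0\<close>, which happens in cubic graphs, and \<open>4 * q = 0 \<noteq> 2 * q\<close>, when
  \<open>v + 2 * q\<close> is a second common neighbour of \<open>v + q\<close> and \<open>v - q\<close>. This is why \<open>p\<close> and \<open>q\<close> are treated differently.
\<close>

locale generic_steps =
  fixes n p q :: int
  assumes quadruple: "\<not> n dvd 4 * p"
    and double: "\<not> n dvd 2 * p - 2 * q" "\<not> n dvd 2 * p + 2 * q"
    and triple: "\<not> n dvd 3 * p - q" "\<not> n dvd 3 * p + q" "\<not> n dvd 3 * q - p" "\<not> n dvd 3 * q + p"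
begin

lemma non_dvd_halves: "\<not> n dvd 2 * p" "\<not> n dvd p - q" "\<not> n dvd p + q"
  using quadruple double dvd_mult[of n "2 * p" 2] dvd_mult[of n "p - q" 2] dvd_mult[of n "p + q" 2]
  by (auto simp: algebra_simps)

lemmas non_dvd = quadruple double triple non_dvd_halves

lemma opposite_common:
  assumes "r \<in> steps n p q" "r - 2 * p \<in> steps n p q"
  shows "[r = p] (mod n)"
proof -
  obtain e e' where e: "e \<in> {p, - p, q, - q}" "e' \<in> {p, - p, q, - q}" "[r = e] (mod n)"
    and d: "n dvd e - e' - 2 * p"
    using assms by (rule steps_differenceE)
  have "\<not> n dvd e - e' - 2 * p" if "e \<in> {- p, q, - q}"
    using that e(2)
    by (elim insertE emptyE; hypsubst; insert non_dvd;
        simp add: dvd_uminus_diff dvd_diff_commute algebra_simps)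
  with e(1,3) d show ?thesis by blast
qed

lemma adjacent_common:
  assumes "r \<in> steps n p q" "r - (q - p) \<in> steps n p q"
  shows "[r = - p] (mod n) \<or> [r = q] (mod n)"
proof -
  obtain e e' where e: "e \<in> {p, - p, q, - q}" "e' \<in> {p, - p, q, - q}" "[r = e] (mod n)"
    and d: "n dvd e - e' - (q - p)"
    using assms by (rule steps_differenceE)
  \<comment> \<open>For \<open>2 * q = 0\<close> the representatives \<open>q\<close> and \<open>- q\<close> describe the same step.\<close>
  have "\<not> n dvd e - e' - (q - p)" if "e = p \<or> e = - q \<and> \<not> n dvd 2 * q"
    using that e(2)
    by (elim insertE emptyE disjE conjE; hypsubst; insert non_dvd;
        simp add: dvd_uminus_diff dvd_diff_commute algebra_simps)
  with e(1) d have "e = - p \<or> e = q \<or> e = - q \<and> n dvd 2 * q"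
    by blast
  moreover have "[- q = q] (mod n)" if "n dvd 2 * q"
    using that dvd_minus_iff[of n "2 * q"] by (simp add: cong_iff_dvd_diff)
  ultimately show ?thesis
    using e(3) by (auto intro: cong_trans)
qed

end

section \<open>Automorphisms and parallelograms\<close>

text \<open>
  An automorphism, lifted along \<open>\<int> \<rightarrow> \<int>\<^sub>n\<close>; only the residues of its values matter.
\<close>

locale circulant_automorphism =
  fixes n p q :: int and f :: "int \<Rightarrow> int"
  assumes cong_iff: "[f x = f y] (mod n) \<longleftrightarrow> [x = y] (mod n)"
    and surj: "\<exists>x. [f x = y] (mod n)"
    and step_iff: "f x - f y \<in> steps n p q \<longleftrightarrow> x - y \<in> steps n p q"
begin

text \<open>
  The point \<open>f (v + s) + f (v + s') - f v\<close> is a common neighbour of \<open>f (v + s)\<close> and \<open>f (v + s')\<close>. Its preimage is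
  therefore one of the two points \<open>v\<close>, \<open>w\<close>, and it can be \<open>v\<close> only if the two image edges are opposite. For
  \<open>w = v\<close> this shows that the images of \<open>v + s\<close> and \<open>v + s'\<close> are opposite at \<open>f v\<close> if \<open>v\<close> is the unique common
  neighbour of the two.
\<close>

lemma completes_parallelogram:
  assumes s: "s \<in> steps n p q" and s': "s' \<in> steps n p q"
    and common: "\<And>u. u - (v + s) \<in> steps n p q \<Longrightarrow> u - (v + s') \<in> steps n p q \<Longrightarrow>
      [u = v] (mod n) \<or> [u = w] (mod n)"
    and apart: "\<not> [f (v + s) + f (v + s') = 2 * f v] (mod n) \<or> [v = w] (mod n)"
  shows "[f w + f v = f (v + s) + f (v + s')] (mod n)"
proof -
  obtain u where u: "[f u = f (v + s) + f (v + s') - f v] (mod n)"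
    using surj by blast
  have "[f u - f (v + s) = f (v + s') - f v] (mod n)" "[f u - f (v + s') = f (v + s) - f v] (mod n)"
    using u by (simp_all add: cong_iff_dvd_diff algebra_simps)
  moreover have "f (v + s) - f v \<in> steps n p q" "f (v + s') - f v \<in> steps n p q"
    using s s' by (simp_all add: step_iff)
  ultimately have "u - (v + s) \<in> steps n p q" "u - (v + s') \<in> steps n p q"
    using steps_cong step_iff by blast+
  then have "[u = v] (mod n) \<or> [u = w] (mod n)"
    by (rule common)
  moreover have "[u = w] (mod n)" if "[u = v] (mod n)"
  proof -
    have "[f u = f v] (mod n)"
      using that by (simp add: cong_iff)
    then have "n dvd (f u - f v) - (f u - (f (v + s) + f (v + s') - f v))"
      using u unfolding cong_iff_dvd_diff by (rule dvd_diff)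
    then have "[f (v + s) + f (v + s') = 2 * f v] (mod n)"
      by (simp add: cong_iff_dvd_diff algebra_simps)
    with apart that show ?thesis
      by (auto intro: cong_trans)
  qed
  ultimately have "[f w = f u] (mod n)"
    by (auto simp: cong_iff cong_sym)
  then show ?thesis
    using dvd_add[OF u[unfolded cong_iff_dvd_diff]] by (fastforce simp: cong_iff_dvd_diff algebra_simps)
qed

end

section \<open>Vanishing second differences\<close>

lemma int_subgroup_gcd:
  fixes A :: "int set"
  assumes diff: "\<And>x y. x \<in> A \<Longrightarrow> y \<in> A \<Longrightarrow> x - y \<in> A" and "a \<in> A" "b \<in> A"
  shows "gcd a b \<in> A"
proof -
  have zero: "0 \<in> A" using diff[OF \<open>a \<in> A\<close> \<open>a \<in> A\<close>] by simp
  have uminus: "- x \<in> A" if "x \<in> A" for x using diff[OF zero that] by simp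
  have add: "x + y \<in> A" if "x \<in> A" "y \<in> A" for x y using diff[OF that(1) uminus[OF that(2)]] by simp
  have mult: "k * x \<in> A" if "x \<in> A" for k x
  proof (induction k rule: int_induct[of _ 0])
    case base show ?case using zero by simp
  next
    case (step1 i) from add[OF step1(2) that] show ?case by (simp add: algebra_simps)
  next
    case (step2 i) from diff[OF step2(2) that] show ?case by (simp add: algebra_simps)
  qed
  obtain u v where "u * a + v * b = gcd a b"
    using bezout_int by blast
  with add[OF mult[OF \<open>a \<in> A\<close>] mult[OF \<open>b \<in> A\<close>]] show ?thesis by metis
qed

lemma int_subgroup_full:
  fixes A :: "int set"
  assumes "\<And>x y. x \<in> A \<Longrightarrow> y \<in> A \<Longrightarrow> x - y \<in> A" "n \<in> A" "p \<in> A" "q \<in> A"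
    and "gcd n (gcd p q) = 1"
  shows "1 \<in> A"
  using int_subgroup_gcd[of A n "gcd p q"] int_subgroup_gcd[of A p q] assms by simp

lemma constant_if_periodic:
  fixes g :: "int \<Rightarrow> int"
  assumes "gcd n (gcd p q) = 1"
    and period: "\<And>x. [g (x + n) = g x] (mod n)" "\<And>x. [g (x + p) = g x] (mod n)"
      "\<And>x. [g (x + q) = g x] (mod n)"
  shows "[g x = g y] (mod n)"
proof -
  define A where "A = {u. \<forall>x. [g (x + u) = g x] (mod n)}"
  have diff: "u - w \<in> A" if "u \<in> A" "w \<in> A" for u w
  proof -
    have "[g (x + (u - w)) = g x] (mod n)" for x
    proof -
      have "[g ((x - w) + u) = g (x - w)] (mod n)" "[g ((x - w) + w) = g (x - w)] (mod n)"
        using that unfolding A_def by blast+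
      from cong_trans[OF this(1) cong_sym[OF this(2)]] show ?thesis
        by (simp add: algebra_simps)
    qed
    then show ?thesis by (simp add: A_def)
  qed
  have one: "1 \<in> A"
    by (rule int_subgroup_full[OF diff _ _ _ assms(1)]) (auto simp: A_def period)
  have "k \<in> A" for k
  proof (induction k rule: int_induct[of _ 0])
    case base show ?case by (simp add: A_def)
  next
    case (step1 i)
    have "0 \<in> A" by (simp add: A_def)
    from diff[OF step1(2) diff[OF this one]] show ?case by simp
  next
    case (step2 i) from diff[OF step2(2) one] show ?case .
  qed
  then have "[g (y + (x - y)) = g y] (mod n)"
    unfolding A_def by blast
  then show ?thesis by simp
qed

text \<open>
  The first difference of \<open>f\<close> in the step \<open>p\<close> has periods \<open>n\<close>, \<open>p\<close> and \<open>q\<close>, which generate \<open>\<int>\<close>, so it is constant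
  modulo \<open>n\<close>; the same holds for \<open>q\<close>. The steps in which the first difference is constant form a subgroup, so \<open>1\<close> is one of them.
\<close>

lemma affine_if_second_differences_vanish:
  fixes f :: "int \<Rightarrow> int"
  assumes gcd: "gcd n (gcd p q) = 1"
    and n: "\<And>x. [f (x + n) = f x] (mod n)"
    and pp: "\<And>x. [f (x + p + p) + f x = f (x + p) + f (x + p)] (mod n)"
    and pq: "\<And>x. [f (x + p + q) + f x = f (x + p) + f (x + q)] (mod n)"
    and qq: "\<And>x. [f (x + q + q) + f x = f (x + q) + f (x + q)] (mod n)"
  shows "[f x = f 0 + (f 1 - f 0) * x] (mod n)"
proof -
  define A where "A = {u. \<forall>x y. [f (x + u) - f x = f (y + u) - f y] (mod n)}"
  have const: "u \<in> A"
    if "\<And>x. [f (x + p + u) - f (x + p) = f (x + u) - f x] (mod n)"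
      "\<And>x. [f (x + q + u) - f (x + q) = f (x + u) - f x] (mod n)" for u
  proof -
    have "[f (x + n + u) - f (x + n) = f (x + u) - f x] (mod n)" for x
      using cong_diff[OF n[of "x + u"] n[of x]] by (simp add: ac_simps)
    from constant_if_periodic[OF gcd, of "\<lambda>x. f (x + u) - f x", OF this that]
    show ?thesis by (simp add: A_def)
  qed
  have "p \<in> A" "q \<in> A"
    using pp pq qq by (auto intro!: const simp: cong_iff_dvd_diff algebra_simps)
  moreover have "n \<in> A"
    unfolding A_def using cong_diff[OF n cong_refl, of _ "f _"]
    by (auto simp: cong_iff_dvd_diff intro: dvd_diff)
  moreover have "u - w \<in> A" if "u \<in> A" "w \<in> A" for u w
  proof -
    have "[f (x + (u - w)) - f x = f (y + (u - w)) - f y] (mod n)" for x y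
    proof -
      have "[f (x - w + u) - f (x - w) = f (y - w + u) - f (y - w)] (mod n)"
        "[f (x - w + w) - f (x - w) = f (y - w + w) - f (y - w)] (mod n)"
        using that unfolding A_def by blast+
      from cong_diff[OF this] show ?thesis by (simp add: algebra_simps)
    qed
    then show ?thesis by (simp add: A_def)
  qed
  ultimately have "1 \<in> A"
    using gcd by (intro int_subgroup_full[of A n p q]) auto
  then have step: "[f (x + 1) - f x = f (0 + 1) - f 0] (mod n)" for x
    unfolding A_def by blast
  show ?thesis
  proof (induction x rule: int_induct[of _ 0])
    case base show ?case by simp
  next
    case (step1 x)
    from cong_add[OF step1(2) step[of x]] show ?case by (simp add: algebra_simps)
  next
    case (step2 x)
    from cong_diff[OF step2(2) step[of "x - 1"]] show ?case by (simp add: algebra_simps)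
  qed
qed

section \<open>Affinity in the absence of coincidences\<close>

text \<open>
  If \<open>\<plusminus>x\<close> is one of the two pairs of opposite steps, then \<open>y\<close> and \<open>y'\<close> lie in the other one. The last hypothesis
  says that they are distinct unless \<open>q\<close> is an involution. In that case \<open>x\<close>, which is not an
  involution, is \<open>\<plusminus>p\<close>, and \<open>y\<close> and \<open>y'\<close> are both \<open>q\<close>.
\<close>

lemma complementary_steps:
  assumes "x \<in> steps n p q" "y \<in> steps n p q" "y' \<in> steps n p q"
    and "\<not> n dvd x + x" "\<not> n dvd y - x" "\<not> n dvd y + x" "\<not> n dvd y' - x" "\<not> n dvd y' + x"
    and "n dvd y - y' \<longleftrightarrow> n dvd 2 * q"
  shows "n dvd y + y'"
proof -
  obtain a b b' where e: "a \<in> {p, - p, q, - q}" "b \<in> {p, - p, q, - q}" "b' \<in> {p, - p, q, - q}"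
    and c: "[x = a] (mod n)" "[y = b] (mod n)" "[y' = b'] (mod n)"
    using assms(1-3) unfolding steps_def by blast
  have "\<not> n dvd a + a" "\<not> n dvd b - a" "\<not> n dvd b + a" "\<not> n dvd b' - a" "\<not> n dvd b' + a"
    "n dvd b - b' \<longleftrightarrow> n dvd 2 * q"
    using assms(4-9) cong_dvd_iff[OF cong_add[OF c(1) c(1)]]
      cong_dvd_iff[OF cong_diff[OF c(2) c(1)]] cong_dvd_iff[OF cong_add[OF c(2) c(1)]]
      cong_dvd_iff[OF cong_diff[OF c(3) c(1)]] cong_dvd_iff[OF cong_add[OF c(3) c(1)]]
      cong_dvd_iff[OF cong_diff[OF c(2) c(3)]] by simp_all
  with e have "n dvd b + b'"
    by (elim insertE emptyE; hypsubst;
        simp add: dvd_uminus_diff dvd_diff_commute algebra_simps)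
  then show ?thesis
    using cong_dvd_iff[OF cong_add[OF c(2,3)]] by simp
qed

context circulant_automorphism
begin

lemma periodic: "[f (x + n) = f x] (mod n)"
  by (simp add: cong_iff) (simp add: cong_iff_dvd_diff)

lemma image_step: "s \<in> steps n p q \<Longrightarrow> f (v + s) - f v \<in> steps n p q"
  by (simp add: step_iff)

lemma incongruent_images: "\<not> [s = s'] (mod n) \<Longrightarrow> \<not> [f (v + s) - f v = f (v + s') - f v] (mod n)"
  using cong_iff[of "v + s" "v + s'"] by (simp add: cong_iff_dvd_diff)

end

locale generic_circulant_automorphism = circulant_automorphism + generic_steps
begin

lemma opposite_p: "[f (v + p) + f (v - p) = 2 * f v] (mod n)"
proof -
  have "[u = v] (mod n)" if "u - (v + p) \<in> steps n p q" "u - (v - p) \<in> steps n p q" for u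
  proof -
    have "[u - (v - p) = p] (mod n)"
      using that by (intro opposite_common) (simp_all add: algebra_simps)
    then show ?thesis by (simp add: cong_iff_dvd_diff)
  qed
  then have "[f v + f v = f (v + p) + f (v + - p)] (mod n)"
    by (intro completes_parallelogram) (simp_all add: steps_members)
  then show ?thesis
    by (simp add: cong_sym)
qed

lemma parallelogram: "[f (v + p + q) + f v = f (v + p) + f (v + q)] (mod n)"
proof (rule completes_parallelogram)
  fix u assume "u - (v + p) \<in> steps n p q" "u - (v + q) \<in> steps n p q"
  then have "[u - (v + p) = - p] (mod n) \<or> [u - (v + p) = q] (mod n)"
    by (intro adjacent_common) (simp_all add: algebra_simps)
  then show "[u = v] (mod n) \<or> [u = v + p + q] (mod n)"
    by (simp add: cong_iff_dvd_diff algebra_simps)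
next
  have "[f (v + q) = f (v - p)] (mod n)" if "[f (v + p) + f (v + q) = 2 * f v] (mod n)"
    using cong_diff[OF that opposite_p[of v]] by (simp add: cong_iff_dvd_diff)
  moreover have "\<not> [v + q = v - p] (mod n)"
    using non_dvd_halves(3) by (simp add: cong_iff_dvd_diff add.commute)
  ultimately show "\<not> [f (v + p) + f (v + q) = 2 * f v] (mod n) \<or> [v = v + p + q] (mod n)"
    unfolding cong_iff by blast
qed (simp_all add: steps_members)

text \<open>
  When \<open>4 * q = 0 \<noteq> 2 * q\<close>, the vertices \<open>v + q\<close> and \<open>v - q\<close> have two common neighbours and the argument for \<open>p\<close> fails. But \<open>f\<close>
  respects the pair \<open>\<plusminus>p\<close>, hence also the complementary pair.
\<close>

lemma opposite_q: "[f (v + q) + f (v - q) = 2 * f v] (mod n)"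
proof -
  define x x' y y' where images: "x = f (v + p) - f v" "x' = f (v + - p) - f v"
    "y = f (v + q) - f v" "y' = f (v + - q) - f v"
  have S: "x \<in> steps n p q" "y \<in> steps n p q" "y' \<in> steps n p q"
    unfolding images by (intro image_step steps_members)+
  have "[x' = - x] (mod n)"
    using opposite_p[of v] by (simp add: images cong_iff_dvd_diff algebra_simps)
  have "\<not> [p = - p] (mod n)" "\<not> [q = p] (mod n)" "\<not> [q = - p] (mod n)"
    "\<not> [- q = p] (mod n)" "\<not> [- q = - p] (mod n)"
    using non_dvd_halves
    by (auto simp: cong_iff_dvd_diff dvd_uminus_diff dvd_diff_commute algebra_simps)
  from this[THEN incongruent_images[of _ _ v]]
  have "\<not> [x = - x] (mod n)" "\<not> [y = x] (mod n)" "\<not> [y = - x] (mod n)"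
    "\<not> [y' = x] (mod n)" "\<not> [y' = - x] (mod n)"
    unfolding images[symmetric] using \<open>[x' = - x] (mod n)\<close> by (metis cong_sym cong_trans)+
  then have nd: "\<not> n dvd x - - x" "\<not> n dvd y - x" "\<not> n dvd y - - x" "\<not> n dvd y' - x" "\<not> n dvd y' - - x"
    by (simp_all add: cong_iff_dvd_diff)
  have yy': "n dvd y - y' \<longleftrightarrow> n dvd 2 * q"
  proof -
    have "n dvd y - y' \<longleftrightarrow> [f (v + q) = f (v + - q)] (mod n)"
      by (simp add: images cong_iff_dvd_diff)
    also have "\<dots> \<longleftrightarrow> n dvd 2 * q"
      by (simp add: cong_iff) (simp add: cong_iff_dvd_diff)
    finally show ?thesis .
  qed
  have "n dvd y + y'"
    using complementary_steps[OF S] nd yy' by simp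
  then show ?thesis
    by (simp add: images cong_iff_dvd_diff algebra_simps)
qed

lemma affine:
  assumes "gcd n (gcd p q) = 1"
  shows "[f x = f 0 + (f 1 - f 0) * x] (mod n)"
proof (rule affine_if_second_differences_vanish[OF assms])
  show "[f (x + n) = f x] (mod n)" for x
    by (rule periodic)
  show "[f (x + p + p) + f x = f (x + p) + f (x + p)] (mod n)" for x
    using opposite_p[of "x + p"] by simp
  show "[f (x + q + q) + f x = f (x + q) + f (x + q)] (mod n)" for x
    using opposite_q[of "x + q"] by simp
qed (rule parallelogram)

end

section \<open>Affinity when one step is three times the other\<close>

lemma steps_triple: "s \<in> steps n p (3 * p) \<longleftrightarrow> (\<exists>k \<in> {1, -1, 3, -3}. [s = k * p] (mod n))"
  by (simp add: steps_def)

text \<open>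
  The four conditions say that distinct elements of \<open>{1, -1, 3, -3}\<close> are incongruent, and that \<open>4\<close> is a difference of two of
  them modulo \<open>n\<close> only as \<open>3 - (-1)\<close> and \<open>1 - (-3)\<close>. For \<open>6\<close> the additional representation \<open>-3 - 3\<close> is possible
  when \<open>n = 12\<close>, which still leaves fewer than three.
\<close>

locale triple_steps =
  fixes n p :: int
  assumes coprime: "coprime n p"
    and non_dvd_even: "\<not> n dvd 4" "\<not> n dvd 6" "\<not> n dvd 8" "\<not> n dvd 10"
begin

lemma not_dvd_2: "\<not> n dvd 2"
  using non_dvd_even(1) dvd_mult[of n 2 2] by auto

lemma cong_multiple: "[k * p = k' * p] (mod n) \<longleftrightarrow> n dvd k - k'"
  using cong_mult_rcancel[of p n k k'] coprime
  by (simp add: coprime_commute cong_iff_dvd_diff)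

text \<open>
  Two vertices at difference \<open>d\<close> have at least three common neighbours.
\<close>

definition triply_represented :: "int \<Rightarrow> bool" where
  "triply_represented d \<longleftrightarrow> (\<exists>r1 r2 r3. {r1, r2, r3} \<union> {r1 - d, r2 - d, r3 - d} \<subseteq> steps n p (3 * p) \<and>
    \<not> [r1 = r2] (mod n) \<and> \<not> [r1 = r3] (mod n) \<and> \<not> [r2 = r3] (mod n))"

lemma triply_represented_cong:
  assumes "[d = d'] (mod n)" "triply_represented d"
  shows "triply_represented d'"
proof -
  have "r - d \<in> steps n p (3 * p) \<longleftrightarrow> r - d' \<in> steps n p (3 * p)" for r
    by (intro steps_cong cong_diff cong_refl assms)
  with assms(2) show ?thesis
    unfolding triply_represented_def by simp
qed

lemma triply_represented_2p: "triply_represented (2 * p)" "triply_represented (- (2 * p))"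
proof -
  have "\<not> [3 * p = 1 * p] (mod n)" "\<not> [3 * p = (-1) * p] (mod n)" "\<not> [1 * p = (-1) * p] (mod n)"
    "\<not> [(-3) * p = 1 * p] (mod n)" "\<not> [(-3) * p = (-1) * p] (mod n)"
    unfolding cong_multiple using not_dvd_2 non_dvd_even by auto
  moreover have "{3 * p, 1 * p, -1 * p} \<union> {3 * p - 2 * p, 1 * p - 2 * p, -1 * p - 2 * p} \<subseteq> steps n p (3 * p)"
    "{-3 * p, 1 * p, -1 * p} \<union> {-3 * p - - (2 * p), 1 * p - - (2 * p), -1 * p - - (2 * p)} \<subseteq> steps n p (3 * p)"
    by (auto simp: steps_def)
  ultimately show "triply_represented (2 * p)" "triply_represented (- (2 * p))"
    unfolding triply_represented_def by blast+
qed

lemma doubly_represented: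
  assumes "r \<in> steps n p (3 * p)" "r - e * p \<in> steps n p (3 * p)"
    and "(e, a, b) \<in> {(4, 1, 3), (-4, -1, -3), (6, 3, -3), (-6, 3, -3)}"
  shows "[r = a * p] (mod n) \<or> [r = b * p] (mod n)"
proof -
  obtain l l' where l: "l \<in> {1, -1, 3, -3}" "l' \<in> {1, -1, 3, -3}"
    "[r = l * p] (mod n)" "[r - e * p = l' * p] (mod n)"
    using assms(1,2) unfolding steps_triple by blast
  have "[(l - e) * p = l' * p] (mod n)"
    using cong_trans[OF cong_diff[OF l(3)[THEN cong_sym] cong_refl] l(4)] by (simp add: algebra_simps)
  then have "n dvd l - e - l'"
    by (simp add: cong_multiple)
  with l(1,2) assms(3) have "l = a \<or> l = b"
    using not_dvd_2 non_dvd_even by (elim insertE emptyE; simp)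
  with l(3) show ?thesis by auto
qed

lemma triply_represented_step_diff:
  assumes "k \<in> {1, -1, 3, -3}" "k' \<in> {1, -1, 3, -3}" "k \<noteq> k'" "triply_represented ((k - k') * p)"
  shows "k - k' \<in> {2, -2}"
proof (rule ccontr)
  assume "k - k' \<notin> {2, -2}"
  with assms(1-3) have "k - k' \<in> {4, -4, 6, -6}" by auto
  then obtain a b :: int where ab: "(k - k', a, b) \<in> {(4, 1, 3), (-4, -1, -3), (6, 3, -3), (-6, 3, -3)}"
    by blast
  from assms(4) obtain r1 r2 r3 where
    r: "{r1, r2, r3} \<union> {r1 - (k - k') * p, r2 - (k - k') * p, r3 - (k - k') * p} \<subseteq> steps n p (3 * p)"
    "\<not> [r1 = r2] (mod n)" "\<not> [r1 = r3] (mod n)" "\<not> [r2 = r3] (mod n)"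
    unfolding triply_represented_def by blast
  have "[r = a * p] (mod n) \<or> [r = b * p] (mod n)" if "r \<in> {r1, r2, r3}" for r
    using that r(1) by (intro doubly_represented[OF _ _ ab]) auto
  from this[of r1] this[of r2] this[of r3] r(2-4) show False
    by (auto simp: cong_def)
qed

text \<open>
  The steps form the path \<open>3p, p, -p, -3p\<close> when two of them are joined if their difference is triply represented. The steps with
  two neighbours on this path are the inner ones.
\<close>

lemma middle_step:
  assumes "x \<in> steps n p (3 * p)" "y \<in> steps n p (3 * p)" "z \<in> steps n p (3 * p)"
    and "\<not> [x = y] (mod n)" "\<not> [x = z] (mod n)" "\<not> [y = z] (mod n)"
    and "triply_represented (x - y)" "triply_represented (x - z)"
  shows "[x = p] (mod n) \<or> [x = - p] (mod n)"
proof -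
  obtain k l m where k: "k \<in> {1, -1, 3, -3}" "l \<in> {1, -1, 3, -3}" "m \<in> {1, -1, 3, -3}"
    "[x = k * p] (mod n)" "[y = l * p] (mod n)" "[z = m * p] (mod n)"
    using assms(1-3) unfolding steps_triple by blast
  have ne: "k \<noteq> l" "k \<noteq> m" "l \<noteq> m"
    using assms(4-6) k(4-6) by (metis cong_sym cong_trans)+
  have diffs: "[x - y = (k - l) * p] (mod n)" "[x - z = (k - m) * p] (mod n)"
    using cong_diff[OF k(4) k(5)] cong_diff[OF k(4) k(6)] by (simp_all add: algebra_simps)
  have "k - l \<in> {2, -2}" "k - m \<in> {2, -2}"
    by (rule triply_represented_step_diff[OF k(1,2) ne(1) triply_represented_cong[OF diffs(1) assms(7)]],
        rule triply_represented_step_diff[OF k(1,3) ne(2) triply_represented_cong[OF diffs(2) assms(8)]])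
  with k(1-3) ne have "k = 1 \<or> k = - 1" by auto
  with k(4) show ?thesis by auto
qed

end

locale triple_circulant_automorphism = circulant_automorphism n p "3 * p" f + triple_steps n p
  for n p :: int and f :: "int \<Rightarrow> int"
begin

lemma triply_represented_image:
  assumes "triply_represented (x - y)"
  shows "triply_represented (f x - f y)"
proof -
  obtain r1 r2 r3 where
    r: "{r1, r2, r3} \<union> {r1 - (x - y), r2 - (x - y), r3 - (x - y)} \<subseteq> steps n p (3 * p)"
    "\<not> [r1 = r2] (mod n)" "\<not> [r1 = r3] (mod n)" "\<not> [r2 = r3] (mod n)"
    using assms unfolding triply_represented_def by blast
  define g where "g r = f (y + r) - f y" for r
  have "g r \<in> steps n p (3 * p) \<and> g r - (f x - f y) \<in> steps n p (3 * p)" if "r \<in> {r1, r2, r3}" for r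
  proof
    have "r \<in> steps n p (3 * p)" and d: "r - (x - y) \<in> steps n p (3 * p)"
      using r(1) that by auto
    then show "g r \<in> steps n p (3 * p)"
      unfolding g_def by (intro image_step)
    have "y + r - x = r - (x - y)" "g r - (f x - f y) = f (y + r) - f x"
      by (simp_all add: g_def)
    with d show "g r - (f x - f y) \<in> steps n p (3 * p)"
      using step_iff[of "y + r" x] by metis
  qed
  then have "{g r1, g r2, g r3} \<union> {g r1 - (f x - f y), g r2 - (f x - f y), g r3 - (f x - f y)}
      \<subseteq> steps n p (3 * p)"
    by blast
  moreover have "\<not> [g r1 = g r2] (mod n)" "\<not> [g r1 = g r3] (mod n)" "\<not> [g r2 = g r3] (mod n)"
    unfolding g_def by (intro incongruent_images r(2-4))+
  ultimately show ?thesis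
    unfolding triply_represented_def by blast
qed

lemma middle_image:
  assumes "e \<in> {p, - p}"
  shows "[f (v + e) - f v = p] (mod n) \<or> [f (v + e) - f v = - p] (mod n)"
proof (rule middle_step)
  have "3 * e \<in> steps n p (3 * p)" "e \<in> steps n p (3 * p)" "- e \<in> steps n p (3 * p)"
    using assms by (auto simp: steps_def)
  then show "f (v + e) - f v \<in> steps n p (3 * p)" "f (v + - e) - f v \<in> steps n p (3 * p)"
    "f (v + 3 * e) - f v \<in> steps n p (3 * p)"
    by (auto intro!: image_step simp del: add_uminus_conv_diff)
  have ne: "\<not> [e = - e] (mod n)" "\<not> [e = 3 * e] (mod n)" "\<not> [- e = 3 * e] (mod n)"
    using assms cong_multiple[of 1 "-1"] cong_multiple[of "-1" 1] cong_multiple[of 1 3]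
      cong_multiple[of "-1" 3] cong_multiple[of "-1" "-3"] cong_multiple[of 1 "-3"]
      not_dvd_2 non_dvd_even(1) by auto
  show "\<not> [f (v + e) - f v = f (v + - e) - f v] (mod n)"
    "\<not> [f (v + e) - f v = f (v + 3 * e) - f v] (mod n)"
    "\<not> [f (v + - e) - f v = f (v + 3 * e) - f v] (mod n)"
    by (rule incongruent_images[OF ne(1)], rule incongruent_images[OF ne(2)],
        rule incongruent_images[OF ne(3)])
  have "triply_represented (f (v + e) - f (v + - e))" "triply_represented (f (v + e) - f (v + 3 * e))"
    using assms triply_represented_2p by (auto intro!: triply_represented_image simp: algebra_simps)
  then show "triply_represented (f (v + e) - f v - (f (v + - e) - f v))"
    "triply_represented (f (v + e) - f v - (f (v + 3 * e) - f v))"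
    by simp_all
qed

lemma opposite: "[f (v + p) + f (v - p) = 2 * f v] (mod n)"
proof -
  define x y where xy: "x = f (v + p) - f v" "y = f (v + - p) - f v"
  have "\<not> [p = - p] (mod n)"
    using cong_multiple[of 1 "-1"] not_dvd_2 by simp
  then have "\<not> [x = y] (mod n)"
    unfolding xy by (rule incongruent_images)
  moreover have "[x = p] (mod n) \<or> [x = - p] (mod n)" "[y = p] (mod n) \<or> [y = - p] (mod n)"
    unfolding xy by (intro middle_image; simp)+
  ultimately have "[x = p] (mod n) \<and> [y = - p] (mod n) \<or> [x = - p] (mod n) \<and> [y = p] (mod n)"
    by (metis cong_sym cong_trans)
  then have "[x + y = 0] (mod n)"
    using cong_add[of x p n y "- p"] cong_add[of x "- p" n y p] by auto
  then show ?thesis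
    by (simp add: xy cong_iff_dvd_diff algebra_simps)
qed

text \<open>
  As \<open>p\<close> is a unit, it generates \<open>\<int>\<^sub>n\<close> without the help of the second step.
\<close>

lemma affine: "[f x = f 0 + (f 1 - f 0) * x] (mod n)"
proof (rule affine_if_second_differences_vanish)
  show "gcd n (gcd p p) = 1"
    using coprime by (simp add: coprime_iff_gcd_eq_1)
  show "[f (x + n) = f x] (mod n)" for x
    by (rule periodic)
qed (use opposite[of "_ + p"] in simp_all)

end

section \<open>Automorphisms of connected circulants are affine\<close>

text \<open>
  The four excluded graphs are \<open>K\<^sub>4\<close>, \<open>K\<^sub>5\<close>, \<open>K\<^sub>3\<^sub>,\<^sub>3\<close>, and \<open>K\<^sub>5\<^sub>,\<^sub>5\<close> without a perfect matching. In the
  complete graphs every permutation of the vertices is an automorphism, in the bipartite ones every permutation of a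
  colour class extends to one, and these are too many to be all affine.
\<close>

lemma circulant_automorphism_affine:
  fixes n i j :: int
  assumes ij: "0 < i" "i < j" "2 * j \<le> n"
    and gcd: "gcd n (gcd i j) = 1"
    and no_open_twins: "\<not> n dvd 2 * i + 2 * j"
    and small: "(n, i, j) \<notin> {(4, 1, 2), (5, 1, 2), (6, 1, 3), (10, 1, 3)}"
    and auto: "circulant_automorphism n i j f"
  shows "[f x = f 0 + (f 1 - f 0) * x] (mod n)"
proof -
  have no_dvd_diff: "\<not> n dvd 2 * j - 2 * i"
    using ij by (auto dest: zdvd_imp_le)
  have auto_swap: "circulant_automorphism n j i f"
    using auto by (simp add: circulant_automorphism_def steps_swap[of n j i])
  have affine_triple: "[f x = f 0 + (f 1 - f 0) * x] (mod n)"
    if auto': "circulant_automorphism n a b f" and ab: "(a, b) \<in> {(i, j), (j, i)}"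
      and dvd: "n dvd 3 * a - b \<or> n dvd 3 * a + b" for a b
  proof -
    have "gcd n a dvd 3 * a - b \<or> gcd n a dvd 3 * a + b"
      using dvd by (auto intro: dvd_trans[OF gcd_dvd1])
    then have "gcd n a dvd b"
      by (auto simp: dvd_diff_right_iff dvd_add_right_iff dvd_mult)
    then have "gcd n a dvd gcd n (gcd i j)"
      using ab by auto
    then have coprime: "coprime n a"
      using gcd by (simp add: coprime_iff_gcd_eq_1)
    \<comment> \<open>For \<open>n = 10\<close> this excludes the steps \<open>2\<close> and \<open>4\<close>, which satisfy \<open>3 * 2 + 4 = 10\<close>.\<close>
    have not_even: "\<not> (2 dvd n \<and> 2 dvd i \<and> 2 dvd j)"
    proof
      assume "2 dvd n \<and> 2 dvd i \<and> 2 dvd j"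
      then have "2 dvd gcd n (gcd i j)" by simp
      with gcd show False by simp
    qed
    \<comment> \<open>If \<open>8 = 0\<close> modulo \<open>n\<close>, then \<open>6 * a = - 2 * a\<close>, so \<open>b = \<plusminus>3 * a\<close> gives \<open>2 * b = \<plusminus>2 * a\<close>.\<close>
    have n8: "\<not> n dvd 8"
    proof
      assume "n dvd 8"
      then have "n dvd 8 * a" by (rule dvd_mult2)
      moreover have "n dvd 2 * (3 * a - b) \<or> n dvd 2 * (3 * a + b)"
        using dvd by (blast intro: dvd_mult)
      ultimately have "n dvd 8 * a - 2 * (3 * a - b) \<or> n dvd 8 * a - 2 * (3 * a + b)"
        by (blast intro: dvd_diff)
      then have "n dvd 2 * a + 2 * b \<or> n dvd 2 * a - 2 * b"
        by (simp add: algebra_simps)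
      then show False
        using ab no_open_twins no_dvd_diff dvd_diff_commute[of n "2 * i" "2 * j"]
        by (auto simp: add.commute)
    qed
    have "\<not> n dvd 6"
    proof
      assume "n dvd 6"
      then have "n \<le> 6" by (simp add: zdvd_imp_le)
      with ij have "n = 4 \<or> n = 5 \<or> n = 6" by linarith
      with \<open>n dvd 6\<close> have "n = 6" by auto
      with ij have "(i, j) \<in> {(1, 2), (1, 3), (2, 3)}" by simp presburger
      with ab \<open>n = 6\<close> dvd small show False by auto
    qed
    moreover have "\<not> n dvd 10"
    proof
      assume "n dvd 10"
      then have "n \<le> 10" by (simp add: zdvd_imp_le)
      with ij have "n = 4 \<or> n = 5 \<or> n = 6 \<or> n = 7 \<or> n = 8 \<or> n = 9 \<or> n = 10"
        by linarith
      with \<open>n dvd 10\<close> have "n = 5 \<or> n = 10" by auto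
      then show False
      proof
        assume "n = 5"
        with ij have "i = 1 \<and> j = 2" by presburger
        with \<open>n = 5\<close> small show False by simp
      next
        assume "n = 10"
        with ij have "i \<in> {1, 2, 3, 4}" "j \<in> {2, 3, 4, 5}" by simp_all presburger+
        with ij(2) ab \<open>n = 10\<close> dvd small not_even show False by (elim insertE emptyE) auto
      qed
    qed
    moreover have "\<not> n dvd 4"
      using n8 dvd_mult[of n 4 2] by auto
    moreover have "steps n a b = steps n a (3 * a)"
      using dvd
    proof
      assume "n dvd 3 * a - b"
      then show ?thesis
        by (intro steps_cong_right) (simp add: cong_iff_dvd_diff dvd_diff_commute)
    next
      assume "n dvd 3 * a + b"
      then have "[- b = 3 * a] (mod n)"
        by (simp add: cong_iff_dvd_diff dvd_uminus_diff add.commute)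
      from steps_cong_right[OF this] show ?thesis
        by (simp add: steps_uminus_right)
    qed
    ultimately interpret triple_circulant_automorphism n a f
      using auto' n8 coprime
      by (simp add: triple_circulant_automorphism_def triple_steps_def circulant_automorphism_def)
    show ?thesis by (rule affine)
  qed
  show ?thesis
  proof (cases "n dvd 3 * i - j \<or> n dvd 3 * i + j \<or> n dvd 3 * j - i \<or> n dvd 3 * j + i")
    case True
    then show ?thesis
      using affine_triple[OF auto] affine_triple[OF auto_swap] by auto
  next
    case False
    have "\<not> n dvd 4 * i \<or> \<not> n dvd 4 * j"
    proof (rule ccontr)
      assume "\<not> ?thesis"
      then have "n dvd gcd (4 * n) (gcd (4 * i) (4 * j))" by simp
      also have "\<dots> = 4 * gcd n (gcd i j)"
        by (simp add: gcd_mult_left abs_mult)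
      finally have "n dvd 4" using gcd by simp
      with ij have "n = 4" by (auto dest: zdvd_imp_le)
      with ij have "i = 1 \<and> j = 2" by presburger
      with \<open>n = 4\<close> small show False by simp
    qed
    then show ?thesis
    proof
      assume "\<not> n dvd 4 * i"
      with False no_open_twins no_dvd_diff
      interpret generic_circulant_automorphism n i j f
        using auto dvd_diff_commute[of n "2 * i" "2 * j"]
        by (simp add: generic_circulant_automorphism_def generic_steps_def)
      show ?thesis using gcd by (rule affine)
    next
      assume "\<not> n dvd 4 * j"
      with False no_open_twins no_dvd_diff
      interpret generic_circulant_automorphism n j i f
        using auto_swap
        by (simp add: generic_circulant_automorphism_def generic_steps_def add.commute)
      show ?thesis using gcd by (intro affine) (simp add: gcd.commute)
    qed
  qed
qed

section \<open>The circulant graph: connectedness and twins\<close>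

lemma pverts_circulant: "pverts (circulant n i j) = {0..n - 1}"
  by (simp add: circulant_def residue_ring_def)

lemma parcs_circulant:
  "(a, b) \<in> parcs (circulant n i j) \<longleftrightarrow> a \<in> {0..n - 1} \<and> b \<in> {0..n - 1} \<and> a - b \<in> steps n i j"
  by (simp add: circulant_def residue_ring_def steps_def)

lemma gcd_dvd_steps:
  assumes "s \<in> steps n i j"
  shows "gcd n (gcd i j) dvd s"
proof -
  let ?g = "gcd n (gcd i j)"
  obtain e where "e \<in> {i, - i, j, - j}" "[s = e] (mod n)"
    using assms unfolding steps_def by blast
  moreover have "?g dvd i" "?g dvd j"
    using dvd_trans[OF gcd_dvd2[of n "gcd i j"]] by simp_all
  ultimately have "?g dvd e" "[s = e] (mod ?g)"
    by (auto intro: cong_dvd_modulus)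
  then show ?thesis
    using cong_dvd_iff by blast
qed

lemma connected_circulant_gcd:
  assumes "1 < n" and "Digraph_Component.connected (with_proj (circulant n i j))"
  shows "gcd n (gcd i j) = 1"
proof -
  let ?G = "with_proj (mk_symmetric (with_proj (circulant n i j)))"
  have "0 \<rightarrow>\<^sup>*\<^bsub>?G\<^esub> 1"
    using assms by (auto simp: connected_def strongly_connected_def pverts_circulant)
  then have "gcd n (gcd i j) dvd 1"
    unfolding reachable_def
  proof (induction rule: rtrancl_on_induct)
    case base
    show ?case by simp
  next
    case (step x y)
    then have "(x, y) \<in> parcs (circulant n i j) \<or> (y, x) \<in> parcs (circulant n i j)"
      by (auto simp: mk_symmetric_def)
    then have "gcd n (gcd i j) dvd x - y \<or> gcd n (gcd i j) dvd y - x"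
      unfolding parcs_circulant using gcd_dvd_steps by blast
    with step.IH show ?case
      by (auto simp: dvd_diff_right_iff dvd_diff_left_iff)
  qed
  then show ?thesis by simp
qed

lemma nbhd_circulant:
  assumes "v \<in> {0..n - 1}"
  shows "nbhd (circulant n i j) v = {w \<in> {0..n - 1}. v - w \<in> steps n i j}"
  using assms by (auto simp: nbhd_def pverts_circulant parcs_circulant)

lemma not_twin_free_if_shift_invariant:
  assumes d: "0 < d" "d < n"
    and shift: "\<And>s. s \<in> steps n i j \<Longrightarrow> s + d \<in> steps n i j"
  shows "\<not> twin_free (circulant n i j)"
proof -
  have "0 - w \<in> steps n i j \<longleftrightarrow> d - w \<in> steps n i j" for w
  proof
    assume "0 - w \<in> steps n i j"
    from shift[OF this] show "d - w \<in> steps n i j" by simp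
  next
    assume "d - w \<in> steps n i j"
    then have "- (d - w) \<in> steps n i j" by (simp only: steps_uminus)
    from shift[OF this] have "- (0 - w) \<in> steps n i j" by simp
    then show "0 - w \<in> steps n i j" by (simp only: steps_uminus)
  qed
  then have "twins (circulant n i j) 0 d"
    using d by (simp add: twins_def nbhd_circulant)
  moreover have "0 \<in> {0..n - 1}" "d \<in> {0..n - 1}"
    using d by simp_all
  ultimately show ?thesis
    unfolding twin_free_def pverts_circulant by blast
qed

lemma not_twin_free_if_complete:
  assumes "1 < n" and complete: "\<And>s. \<not> n dvd s \<Longrightarrow> s \<in> steps n i j"
  shows "\<not> twin_free (circulant n i j)"
proof -
  have "closed_nbhd (circulant n i j) v = {0..n - 1}" if "v \<in> {0..n - 1}" for v
  proof -
    have "v - w \<in> steps n i j" if "w \<in> {0..n - 1}" "w \<noteq> v" for w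
    proof -
      have "\<not> n dvd v - w"
        using that \<open>v \<in> {0..n - 1}\<close> by (auto simp flip: mod_eq_dvd_iff)
      then show ?thesis by (rule complete)
    qed
    with that show ?thesis
      by (auto simp: closed_nbhd_def nbhd_circulant)
  qed
  with assms(1) have "twins (circulant n i j) 0 1"
    by (simp add: twins_def)
  moreover have "0 \<in> {0..n - 1}" "1 \<in> {0..n - 1}"
    using assms(1) by simp_all
  ultimately show ?thesis
    unfolding twin_free_def pverts_circulant by blast
qed

text \<open>
  If \<open>2i = -2j\<close>, then translation by \<open>i + j\<close>, an element of order two, exchanges \<open>i\<close> with \<open>-j\<close> and \<open>j\<close> with \<open>-i\<close>.
\<close>

lemma twin_free_not_dvd:
  assumes "twin_free (circulant n i j)" "0 < i" "i < j" "2 * j \<le> n"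
  shows "\<not> n dvd 2 * i + 2 * j"
proof
  assume dvd: "n dvd 2 * i + 2 * j"
  have "s + (i + j) \<in> steps n i j" if "s \<in> steps n i j" for s
  proof -
    have reflect: "[s + (i + j) = - e'] (mod n)" if "[s = e] (mod n)" "e + e' = i + j" for e e'
    proof -
      have "s + (i + j) - - e' = (s - e) + (2 * i + 2 * j)"
        using that(2) by simp
      with dvd_add[OF that(1)[unfolded cong_iff_dvd_diff] dvd] show ?thesis
        by (simp only: cong_iff_dvd_diff)
    qed
    have slide: "[s + (i + j) = e'] (mod n)" if "[s = - e] (mod n)" "e + e' = i + j" for e e'
      using that(1) that(2)[symmetric] by (simp add: cong_iff_dvd_diff)
    show ?thesis
      using \<open>s \<in> steps n i j\<close> reflect[of i j] reflect[of j i] slide[of i j] slide[of j i]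
      by (auto simp: steps_def)
  qed
  with assms show False
    using not_twin_free_if_shift_invariant[of "i + j" n i j] by simp
qed

text \<open>
  These graphs are \<open>K\<^sub>4\<close>, \<open>K\<^sub>5\<close> and \<open>K\<^sub>3\<^sub>,\<^sub>3\<close>.
\<close>

lemma not_twin_free_small:
  assumes "(n, i, j) \<in> {(4, 1, 2), (5, 1, 2), (6, 1, 3)}"
  shows "\<not> twin_free (circulant n i j)"
proof -
  have "\<not> n dvd s \<Longrightarrow> s \<in> steps n i j" if "(n, i, j) \<in> {(4, 1, 2), (5, 1, 2)}" for s
    using that by (auto simp: steps_def cong_def) presburger+
  moreover have "s \<in> steps n i j \<Longrightarrow> s + 2 \<in> steps n i j" if "(n, i, j) = (6, 1, 3)" for s
    using that by (auto simp: steps_def cong_def) presburger+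
  ultimately show ?thesis
    using assms not_twin_free_if_complete[of n i j] not_twin_free_if_shift_invariant[of 2 n i j]
    by auto
qed

section \<open>The affine group and its action\<close>

lemma affine_action_apply:
  assumes "a \<in> {0..n - 1}"
  shows "affine_action n (s, t) a = (s + t * a) mod n"
  using assms by (simp add: affine_action_def residue_ring_def mod_simps)

lemma connection_set_circulant:
  assumes "1 < n"
  shows "connection_set n i j = steps n i j \<inter> {0..n - 1}"
proof -
  interpret residues n "residue_ring n"
    using assms by unfold_locales simp_all
  have "connection_set n i j = (\<lambda>e. e mod n) ` {i, - i, j, - j}"
    by (simp add: connection_set_def res_neg_eq mod_minus_eq)
  also have "\<dots> = {s. \<exists>e \<in> {i, - i, j, - j}. [s = e] (mod n)} \<inter> {0..n - 1}"
    using assms by (auto simp: cong_def)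
  finally show ?thesis by (simp add: steps_def)
qed

lemma units_residue_ring:
  assumes "1 < n"
  shows "t \<in> Units (residue_ring n) \<longleftrightarrow> t \<in> {0..n - 1} \<and> coprime t n"
proof -
  interpret residues n "residue_ring n"
    using assms by unfold_locales simp_all
  have "t \<noteq> 0" if "coprime t n"
    using that assms by auto
  then show ?thesis by (auto simp: res_units_eq order.strict_iff_order)
qed

lemma cong_mult_unit:
  assumes "coprime t (n :: int)"
  shows "[t * x = t * y] (mod n) \<longleftrightarrow> [x = y] (mod n)"
  using assms by (simp add: cong_mult_lcancel coprime_commute)

lemma multipliers_iff:
  assumes n: "1 < n"
  shows "t \<in> multipliers n i j \<longleftrightarrow>
    t \<in> {0..n - 1} \<and> coprime t n \<and> (\<forall>s. t * s \<in> steps n i j \<longleftrightarrow> s \<in> steps n i j)"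
proof (cases "t \<in> {0..n - 1} \<and> coprime t n")
  case True
  let ?C = "steps n i j \<inter> {0..n - 1}" and ?m = "\<lambda>x. t * x mod n"
  have mod_step: "s mod n \<in> ?C \<longleftrightarrow> s \<in> steps n i j" for s
    using n steps_cong[of "s mod n" s n] by simp
  have mod_mult: "?m (s mod n) = t * s mod n" for s
    by (simp add: mod_simps)
  have inj: "inj_on ?m ?C"
    using cong_mult_unit[of t n] True by (fastforce simp: inj_on_def cong_def)
  have "?m ` ?C = ?C \<longleftrightarrow> (\<forall>s. t * s \<in> steps n i j \<longleftrightarrow> s \<in> steps n i j)"
  proof
    assume image: "?m ` ?C = ?C"
    show "\<forall>s. t * s \<in> steps n i j \<longleftrightarrow> s \<in> steps n i j"
    proof (intro allI iffI)
      fix s assume "s \<in> steps n i j"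
      then have "?m (s mod n) \<in> ?C" using mod_step[of s] image by blast
      then show "t * s \<in> steps n i j" unfolding mod_mult mod_step .
    next
      fix s assume "t * s \<in> steps n i j"
      then have "t * s mod n \<in> ?m ` ?C" unfolding image mod_step .
      then obtain c where "c \<in> ?C" "[t * s = t * c] (mod n)" by (auto simp: cong_def)
      then show "s \<in> steps n i j"
        using True steps_cong by (auto simp: cong_mult_unit)
    qed
  next
    assume "\<forall>s. t * s \<in> steps n i j \<longleftrightarrow> s \<in> steps n i j"
    then have "?m ` ?C \<subseteq> ?C" using mod_step by auto
    then show "?m ` ?C = ?C" by (intro endo_inj_surj inj) auto
  qed
  with True show ?thesis
    by (simp add: multipliers_def units_residue_ring[OF n] connection_set_circulant[OF n])
      (simp add: residue_ring_def)
next
  case False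
  then show ?thesis
    by (auto simp: multipliers_def units_residue_ring[OF n])
qed

lemma affine_action_graph_auto:
  assumes n: "1 < n" and t: "t \<in> multipliers n i j"
  shows "affine_action n (s, t) \<in> graph_auto (circulant n i j)"
proof -
  let ?V = "{0..n - 1}" and ?f = "affine_action n (s, t)"
  have cop: "coprime t n" and mult: "\<And>s. t * s \<in> steps n i j \<longleftrightarrow> s \<in> steps n i j"
    using t multipliers_iff[OF n] by blast+
  have V: "?f a \<in> ?V" if "a \<in> ?V" for a
    using n that by (simp add: affine_action_apply)
  have inj: "inj_on ?f ?V"
  proof (rule inj_onI)
    fix a b assume ab: "a \<in> ?V" "b \<in> ?V" "?f a = ?f b"
    then have "[s + t * a = s + t * b] (mod n)"
      by (simp add: affine_action_apply cong_def)
    then have "[a = b] (mod n)"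
      using cop by (simp add: cong_add_lcancel cong_mult_unit)
    with ab show "a = b" by (simp add: cong_def)
  qed
  have "?f ` ?V = ?V"
    by (rule endo_inj_surj) (use V inj in auto)
  with inj have "bij_betw ?f ?V ?V"
    by (simp add: bij_betw_def)
  moreover have "?f \<in> extensional ?V"
    by (simp add: affine_action_def residue_ring_def)
  moreover have "?f a - ?f b \<in> steps n i j \<longleftrightarrow> a - b \<in> steps n i j" if "a \<in> ?V" "b \<in> ?V" for a b
  proof -
    have "[?f a - ?f b = t * (a - b)] (mod n)"
      using that by (simp add: affine_action_apply cong_def mod_simps algebra_simps)
    then show ?thesis
      using steps_cong mult by blast
  qed
  ultimately show ?thesis
    using V by (auto simp: graph_auto_def Bij_def pverts_circulant parcs_circulant)
qed

lemma graph_auto_circulant_automorphism: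
  assumes n: "1 < n" and f: "f \<in> graph_auto (circulant n i j)"
  shows "circulant_automorphism n i j (\<lambda>x. f (x mod n))"
proof
  have bij: "bij_betw f {0..n - 1} {0..n - 1}"
    and adj: "\<And>a b. a \<in> {0..n - 1} \<Longrightarrow> b \<in> {0..n - 1} \<Longrightarrow>
      (f a, f b) \<in> parcs (circulant n i j) \<longleftrightarrow> (a, b) \<in> parcs (circulant n i j)"
    using f by (auto simp: graph_auto_def Bij_def pverts_circulant)
  have V: "x mod n \<in> {0..n - 1}" for x using n by simp
  have fV: "f (x mod n) \<in> {0..n - 1}" for x
    using bij_betwE[OF bij] V by blast
  then have f_mod: "f (x mod n) mod n = f (x mod n)" for x
    using n by (simp add: mod_pos_pos_trivial)
  show "[f (x mod n) = f (y mod n)] (mod n) \<longleftrightarrow> [x = y] (mod n)" for x y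
    unfolding cong_def f_mod using bij_betw_imp_inj_on[OF bij] V by (metis inj_on_eq_iff)
  show "\<exists>x. [f (x mod n) = y] (mod n)" for y
  proof -
    have "y mod n \<in> f ` {0..n - 1}" using V bij by (simp add: bij_betw_def)
    then obtain x where "x \<in> {0..n - 1}" "f x = y mod n" by auto
    then have "[f (x mod n) = y] (mod n)" by (simp add: cong_def)
    then show ?thesis ..
  qed
  show "f (x mod n) - f (y mod n) \<in> steps n i j \<longleftrightarrow> x - y \<in> steps n i j" for x y
  proof -
    have "f (x mod n) - f (y mod n) \<in> steps n i j \<longleftrightarrow> x mod n - y mod n \<in> steps n i j"
      using adj[OF V V, of x y] fV V by (simp add: parcs_circulant)
    also have "\<dots> \<longleftrightarrow> x - y \<in> steps n i j"
      by (rule steps_cong) (simp add: cong_def mod_simps)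
    finally show ?thesis .
  qed
qed

text \<open>
  The translation part is the image of \<open>0\<close> and the multiplier is the common first difference. A vertex that is mapped to
  \<open>f 0 + 1\<close> is an inverse of the multiplier.
\<close>

lemma graph_auto_eq_affine_action:
  assumes n: "1 < n" and f: "f \<in> graph_auto (circulant n i j)"
    and affine: "\<And>x. [f (x mod n) = f 0 + (f (1 mod n) - f 0) * x] (mod n)"
  shows "\<exists>s \<in> {0..n - 1}. \<exists>t \<in> multipliers n i j. f = affine_action n (s, t)"
proof (intro bexI)
  let ?F = "\<lambda>x. f (x mod n)"
  interpret circulant_automorphism n i j ?F
    using n f by (rule graph_auto_circulant_automorphism)
  define t where "t = (f (1 mod n) - f 0) mod n"
  have fV: "f x \<in> {0..n - 1}" if "x \<in> {0..n - 1}" for x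
    using f that by (auto simp: graph_auto_def Bij_def pverts_circulant bij_betw_def)
  then show "f 0 \<in> {0..n - 1}" using n by simp
  have affine_t: "[?F x = f 0 + t * x] (mod n)" for x
  proof -
    have "[f 0 + t * x = f 0 + (f (1 mod n) - f 0) * x] (mod n)"
      by (intro cong_add cong_mult cong_refl) (simp add: t_def cong_def)
    with affine[of x] show ?thesis by (blast intro: cong_trans cong_sym)
  qed
  show "f = affine_action n (f 0, t)"
  proof (rule extensionalityI[of _ "{0..n - 1}"])
    show "f \<in> extensional {0..n - 1}"
      using f by (simp add: graph_auto_def Bij_def pverts_circulant)
    show "affine_action n (f 0, t) \<in> extensional {0..n - 1}"
      by (simp add: affine_action_def residue_ring_def)
    fix x assume x: "x \<in> {0..n - 1}"
    with affine_t[of x] fV[OF x] show "f x = affine_action n (f 0, t) x"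
      by (simp add: affine_action_apply cong_def)
  qed
  show "t \<in> multipliers n i j"
    unfolding multipliers_iff[OF n]
  proof (intro conjI allI)
    show "t \<in> {0..n - 1}" using n by (simp add: t_def)
    obtain x where "[?F x = f 0 + 1] (mod n)"
      using surj by blast
    then have "[f 0 + t * x = f 0 + 1] (mod n)"
      using affine_t[of x] by (blast intro: cong_trans cong_sym)
    then have "[t * x = 1] (mod n)"
      by (simp add: cong_add_lcancel)
    then show "coprime t n"
      using coprime_iff_invertible_int by blast
    show "t * s \<in> steps n i j \<longleftrightarrow> s \<in> steps n i j" for s
    proof -
      have "[?F s - ?F 0 = t * s] (mod n)"
        using cong_diff[OF affine_t[of s] affine_t[of 0]] by simp
      then show ?thesis
        using step_iff[of s 0] steps_cong by simp
    qed
  qed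
qed

lemma affine_group_simps:
  "carrier (affine_group n i j) = {0..n - 1} \<times> multipliers n i j"
  "(s, t) \<otimes>\<^bsub>affine_group n i j\<^esub> (s', t') = ((s + t * s') mod n, t * t' mod n)"
  by (simp_all add: affine_group_def semidirect_def residue_ring_def units_of_def mod_simps)

lemma affine_action_hom:
  assumes n: "1 < n"
  shows "affine_action n \<in> hom (affine_group n i j) (GraphAutoGroup (circulant n i j))"
proof (rule homI)
  fix u v assume uv: "u \<in> carrier (affine_group n i j)" "v \<in> carrier (affine_group n i j)"
  obtain s t s' t' where eq: "u = (s, t)" "v = (s', t')" by fastforce
  have auto: "affine_action n u \<in> graph_auto (circulant n i j)"
    "affine_action n v \<in> graph_auto (circulant n i j)"
    using uv affine_action_graph_auto[OF n] by (auto simp: affine_group_simps)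
  then show "affine_action n u \<in> carrier (GraphAutoGroup (circulant n i j))"
    by (simp add: GraphAutoGroup_def)
  have "affine_action n (u \<otimes>\<^bsub>affine_group n i j\<^esub> v) = compose {0..n - 1} (affine_action n u) (affine_action n v)"
  proof (rule extensionalityI[of _ "{0..n - 1}"])
    fix a assume a: "a \<in> {0..n - 1}"
    have "affine_action n v a \<in> {0..n - 1}"
      using n a by (simp add: eq affine_action_apply)
    moreover have "[(s + t * s') mod n + (t * t' mod n) * a = s + t * s' + t * t' * a] (mod n)"
      by (intro cong_add cong_mult cong_refl) (simp_all add: cong_def)
    moreover have "[s + t * ((s' + t' * a) mod n) = s + t * (s' + t' * a)] (mod n)"
      by (intro cong_add cong_mult cong_refl) (simp add: cong_def)
    ultimately show "affine_action n (u \<otimes>\<^bsub>affine_group n i j\<^esub> v) a =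
        compose {0..n - 1} (affine_action n u) (affine_action n v) a"
      using a by (simp add: eq affine_group_simps affine_action_apply compose_def cong_def distrib_left
        add.assoc mult.assoc)
  qed (simp_all add: eq affine_action_def residue_ring_def affine_group_simps)
  with auto show "affine_action n (u \<otimes>\<^bsub>affine_group n i j\<^esub> v) =
      affine_action n u \<otimes>\<^bsub>GraphAutoGroup (circulant n i j)\<^esub> affine_action n v"
    by (simp add: GraphAutoGroup_def BijGroup_def graph_auto_def pverts_circulant)
qed

lemma affine_action_inj:
  assumes n: "1 < n"
  shows "inj_on (affine_action n) (carrier (affine_group n i j))"
proof (rule inj_onI)
  fix u v assume uv: "u \<in> carrier (affine_group n i j)" "v \<in> carrier (affine_group n i j)"
    and "affine_action n u = affine_action n v"
  moreover obtain s t s' t' where eq: "u = (s, t)" "v = (s', t')" by fastforce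
  ultimately have "affine_action n (s, t) 0 = affine_action n (s', t') 0"
    "affine_action n (s, t) 1 = affine_action n (s', t') 1" by simp_all
  then have "[s = s'] (mod n)" "[s + t = s' + t'] (mod n)"
    using n by (simp_all add: affine_action_apply cong_def)
  from this(1) cong_diff[OF this(2,1)] have "[s = s'] (mod n)" "[t = t'] (mod n)"
    by simp_all
  moreover have "{s, s', t, t'} \<subseteq> {0..n - 1}"
    using uv by (auto simp: eq affine_group_simps multipliers_iff[OF n])
  ultimately show "u = v"
    by (simp add: eq cong_def)
qed

section \<open>The automorphism group\<close>

theorem theorem13:
  fixes n i j :: int
  assumes "0 < i" and "i < j" and "real_of_int j \<le> real_of_int n / 2"
    and "i = 1 \<or> (i \<notin> Units (residue_ring n) \<and> j \<notin> Units (residue_ring n))"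
    and "Digraph_Component.connected (with_proj (circulant n i j))"
    and "twin_free (circulant n i j)"
    and "(n, i, j) \<noteq> (10, 1, 3)"
  shows "affine_action n \<in> Group.iso (affine_group n i j) (GraphAutoGroup (circulant n i j))"
proof -
  have "real_of_int (2 * j) \<le> real_of_int n"
    using assms(3) by simp
  then have j: "2 * j \<le> n"
    by (simp only: of_int_le_iff)
  with assms(1,2) have n: "1 < n"
    by linarith
  have small: "(n, i, j) \<notin> {(4, 1, 2), (5, 1, 2), (6, 1, 3), (10, 1, 3)}"
    using assms(6,7) not_twin_free_small by blast
  have surj: "f \<in> affine_action n ` carrier (affine_group n i j)"
    if f: "f \<in> graph_auto (circulant n i j)" for f
  proof -
    have "[f (x mod n) = f (0 mod n) + (f (1 mod n) - f (0 mod n)) * x] (mod n)" for x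
      by (rule circulant_automorphism_affine[OF assms(1,2) j connected_circulant_gcd[OF n assms(5)]
            twin_free_not_dvd[OF assms(6,1,2) j] small graph_auto_circulant_automorphism[OF n f]])
    then obtain s t where "s \<in> {0..n - 1}" "t \<in> multipliers n i j" "f = affine_action n (s, t)"
      using graph_auto_eq_affine_action[OF n f] by auto
    then show ?thesis
      by (simp add: affine_group_simps)
  qed
  have "affine_action n ` carrier (affine_group n i j) = graph_auto (circulant n i j)"
    using surj affine_action_graph_auto[OF n] by (auto simp: affine_group_simps)
  then show ?thesis
    using affine_action_hom[OF n] affine_action_inj[OF n]
    by (simp add: iso_def bij_betw_def GraphAutoGroup_def)
qed

end
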